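(* If $A\in M_{n\times n}(\mathbb{R})$ is a skew-symmetric matrix, then $\underline{\lambda}_C(A)= \overline{\lambda}_C(A)=0$ for any $C \in K(\mathbb{R}^n)$.
   Context: $M_{n\times n}(\mathbb{R})$ is the space of real $n\times n$ matrices; $\langle\cdot,\cdot\rangle$ is the standard inner product on $\mathbb{R}^n$. $\overline{K}(\mathbb{R}^n)$ is the set of self-dual solid convex cones in $\mathbb{R}^n$: $\overline{C}\in\overline{K}(\mathbb{R}^n)$ if $\alpha u+\beta w\in\overline{C}$ for all $u,w\in\overline{C}$ and $\alpha,\beta\ge 0$; $\overline{C}=\{u\in\mathbb{R}^n\mid \langle w,u\rangle\ge 0\ \forall w\in\overline{C}\}$; and $C^o:=\operatorname{int}\overline{C}\ne\emptyset$. Put $C:=\overline{C}\setminus\{0\}$ and $K(\mathbb{R}^n):=\{C\mid \overline{C}\in\overline{K}(\mathbb{R}^n)\}$. With $\lambda(u,v):=\frac{\langle Au,v\rangle}{\langle u,v\rangle}$ (well defined on $C\times C^o$ and $C^o\times C$), the upper and lower quasi-eigenvalues of $A$ in $C$ are $\overline{\lambda}_C(A):=\sup_{u\in C}\inf_{v\in C^o}\lambda(u,v)$ and $\underline{\lambda}_C(A):=\inf_{v\in C}\sup_{u\in C^o}\lambda(u,v)$. *)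

theory Defs
  imports "HOL-Analysis.Analysis"
begin

definition self_dual_solid_convex_cone :: "(real ^ 'n) set \<Rightarrow> bool" where
  "self_dual_solid_convex_cone Cbar \<longleftrightarrow>
     (\<forall>u\<in>Cbar. \<forall>w\<in>Cbar. \<forall>\<alpha>\<ge>0. \<forall>\<beta>\<ge>0. \<alpha> *\<^sub>R u + \<beta> *\<^sub>R w \<in> Cbar) \<and>
     Cbar = {u. \<forall>w\<in>Cbar. w \<bullet> u \<ge> 0} \<and>
     interior Cbar \<noteq> {}"

text \<open>The members of \<open>punctured_cones\<close>, the set \<open>K(R^n)\<close>, do not contain the origin.\<close>

definition punctured_cones :: "(real ^ 'n) set set" where
  "punctured_cones = {Cbar - {0} | Cbar. self_dual_solid_convex_cone Cbar}"

text \<open>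
  \<open>C\<^sup>o\<close> is the interior of the full cone. The full cone is recovered from the punctured cone
  \<open>C\<close> as \<open>insert 0 C\<close>, see \<open>insert_zero_punctured_cone\<close>.
\<close>

definition cone_interior :: "(real ^ 'n) set \<Rightarrow> (real ^ 'n) set" where
  "cone_interior C = interior (insert 0 C)"

lemma insert_zero_punctured_cone:
  assumes "self_dual_solid_convex_cone Cbar"
  shows "insert 0 (Cbar - {0}) = Cbar"
proof -
  have eq: "Cbar = {u. \<forall>w\<in>Cbar. w \<bullet> u \<ge> 0}"
    using assms unfolding self_dual_solid_convex_cone_def by (elim conjE)
  have "0 \<in> Cbar"
    by (subst eq) simp
  then show ?thesis by blast
qed

definition lambda_quotient :: "real ^ 'n ^ 'n \<Rightarrow> real ^ 'n \<Rightarrow> real ^ 'n \<Rightarrow> real" where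
  "lambda_quotient A u v = ((A *v u) \<bullet> v) / (u \<bullet> v)"

text \<open>
  The quotient need not be bounded in one argument when the other lies on the boundary of the cone, so
  suprema and infima are taken in the extended reals; in the reals they would be
  unspecified on unbounded sets.
\<close>

definition upper_quasi_eigenvalue :: "(real ^ 'n) set \<Rightarrow> real ^ 'n ^ 'n \<Rightarrow> ereal" where
  "upper_quasi_eigenvalue C A = (SUP u\<in>C. INF v\<in>cone_interior C. ereal (lambda_quotient A u v))"

definition lower_quasi_eigenvalue :: "(real ^ 'n) set \<Rightarrow> real ^ 'n ^ 'n \<Rightarrow> ereal" where
  "lower_quasi_eigenvalue C A = (INF v\<in>C. SUP u\<in>cone_interior C. ereal (lambda_quotient A u v))"

end

theory Submission
  imports Defs
begin

text \<open>
  A skew-symmetric \<open>A\<close> satisfies \<open>\<langle>Au, u\<rangle> = 0\<close>. Letting \<open>v\<close> tend to \<open>u\<close> from the interior of the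
  cone therefore makes every inner infimum nonpositive. A variational inequality on the compact base
  of the cone, solved with Brouwer's fixed point theorem, yields a nonzero \<open>u\<close> in the cone such that
  \<open>Au\<close> is in the cone as well, and self-duality makes its inner infimum nonnegative.
  Skew-symmetry turns the lower quasi-eigenvalue into the negative of the upper one.
\<close>

lemma self_dual_cone_comb:
  assumes "self_dual_solid_convex_cone K" "u \<in> K" "w \<in> K" "\<alpha> \<ge> 0" "\<beta> \<ge> 0"
  shows "\<alpha> *\<^sub>R u + \<beta> *\<^sub>R w \<in> K"
proof -
  have "\<forall>u\<in>K. \<forall>w\<in>K. \<forall>\<alpha>\<ge>0. \<forall>\<beta>\<ge>0. \<alpha> *\<^sub>R u + \<beta> *\<^sub>R w \<in> K"
    using assms(1) unfolding self_dual_solid_convex_cone_def by (elim conjE)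
  then show ?thesis
    using assms(2-) by blast
qed

lemma self_dual_cone_mem_iff:
  assumes "self_dual_solid_convex_cone K"
  shows "u \<in> K \<longleftrightarrow> (\<forall>w\<in>K. w \<bullet> u \<ge> 0)"
proof -
  have "K = {u. \<forall>w\<in>K. w \<bullet> u \<ge> 0}"
    using assms unfolding self_dual_solid_convex_cone_def by (elim conjE)
  then have "u \<in> K \<longleftrightarrow> u \<in> {u. \<forall>w\<in>K. w \<bullet> u \<ge> 0}"
    by (rule eqset_imp_iff)
  then show ?thesis
    unfolding mem_Collect_eq .
qed

lemma self_dual_cone_convex:
  assumes "self_dual_solid_convex_cone K"
  shows "convex K"
  unfolding convex_def using self_dual_cone_comb[OF assms] by blast

text \<open>Self-duality exhibits the cone as an intersection of closed half-spaces.\<close>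

lemma self_dual_cone_closed:
  assumes "self_dual_solid_convex_cone K"
  shows "closed K"
proof -
  have "closed (\<Inter>w\<in>K. {u. w \<bullet> u \<ge> 0})"
    by (intro closed_INT ballI closed_halfspace_ge)
  moreover have "(\<Inter>w\<in>K. {u. w \<bullet> u \<ge> 0}) = K"
    by (rule set_eqI) (simp add: self_dual_cone_mem_iff[OF assms, symmetric])
  ultimately show ?thesis
    by (rule subst[where P = closed, rotated])
qed

text \<open>A ball of radius \<open>c\<close> around \<open>v\<close> lies in \<open>K\<close>;
  pairing \<open>u\<close> with the point of this ball furthest in the direction \<open>-u\<close>
  gives the bound. Since \<open>c\<close> does not depend on \<open>u\<close>, slices of the cone by
  hyperplanes normal to \<open>v\<close> are bounded.\<close>

lemma self_dual_cone_interior_inner_ge: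
  assumes K: "self_dual_solid_convex_cone K" and v: "v \<in> interior K"
  obtains c where "c > 0" "\<And>u. u \<in> K \<Longrightarrow> v \<bullet> u \<ge> c * norm u"
proof -
  obtain c where c: "c > 0" "cball v c \<subseteq> K"
    using v mem_interior_cball by blast
  have "v \<bullet> u \<ge> c * norm u" if u: "u \<in> K" for u
  proof (cases "u = 0")
    case False
    have "v - (c / norm u) *\<^sub>R u \<in> K"
      using c False by (intro subsetD[OF c(2)]) (simp add: dist_norm)
    then have "u \<bullet> (v - (c / norm u) *\<^sub>R u) \<ge> 0"
      using self_dual_cone_mem_iff[OF K] u by blast
    then show ?thesis
      using False
      by (simp add: inner_diff_right inner_commute dot_square_norm power2_eq_square)
  qed simp
  with c show ?thesis using that by blast
qed

lemma self_dual_cone_interior_inner_pos: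
  assumes "self_dual_solid_convex_cone K" "v \<in> interior K" "u \<in> K" "u \<noteq> 0"
  shows "u \<bullet> v > 0"
proof -
  obtain c where "c > 0" and c: "\<And>w. w \<in> K \<Longrightarrow> v \<bullet> w \<ge> c * norm w"
    using self_dual_cone_interior_inner_ge[OF assms(1,2)] by blast
  then have "0 < c * norm u"
    using assms(4) by simp
  also have "\<dots> \<le> u \<bullet> v"
    using c[OF assms(3)] by (simp add: inner_commute)
  finally show ?thesis .
qed

text \<open>With \<open>x = y\<close> this gives \<langle>Ax, x\<rangle> = 0; in general it shows
  that swapping the arguments of \<open>lambda_quotient\<close> changes the sign.\<close>

lemma inner_skew_symmetric:
  fixes A :: "real ^ 'n ^ 'n"
  assumes "transpose A = - A"
  shows "(A *v x) \<bullet> y = - ((A *v y) \<bullet> x)"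
proof -
  have "(A *v y) \<bullet> x = (x v* A) \<bullet> y"
    using dot_lmul_matrix[of x A y] by (simp add: inner_commute)
  also have "\<dots> = (transpose A *v x) \<bullet> y"
    by simp
  also have "\<dots> = - ((A *v x) \<bullet> y)"
    by (subst assms) (simp add: matrix_vector_mult_def inner_vec_def sum_negf)
  finally show ?thesis by simp
qed

lemma self_dual_cone_skew_symmetric_point:
  fixes A :: "real ^ 'n ^ 'n"
  assumes K: "self_dual_solid_convex_cone K" and skew: "transpose A = - A"
  obtains u where "u \<in> K" "u \<noteq> 0" "A *v u \<in> K"
proof -
  have "interior K \<noteq> {}"
    using K unfolding self_dual_solid_convex_cone_def by (elim conjE)
  \<comment> \<open>Singletons are not open here, so the interior has a nonzero point
    \<open>e\<close>; normalizing it shows below that the base \<open>B\<close> is nonempty.\<close>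
  moreover have "interior K \<noteq> {0}"
    by (metis not_open_singleton open_interior)
  ultimately obtain e where e: "e \<in> interior K" "e \<noteq> 0"
    by blast
  define B where "B = K \<inter> {u. e \<bullet> u = 1}"
  obtain c where c: "c > 0" "\<And>u. u \<in> K \<Longrightarrow> e \<bullet> u \<ge> c * norm u"
    using self_dual_cone_interior_inner_ge[OF K e(1)] by blast
  have closed_B: "closed B"
    unfolding B_def by (intro closed_Int self_dual_cone_closed[OF K] closed_hyperplane)
  have "norm u \<le> 1 / c" if "u \<in> B" for u
    using c(1) c(2)[of u] that by (simp add: B_def field_simps)
  then have "bounded B"
    by (meson bounded_iff)
  with closed_B have compact_B: "compact B"
    by (simp add: compact_eq_bounded_closed)
  have convex_B: "convex B"
    unfolding B_def by (intro convex_Int self_dual_cone_convex[OF K] convex_hyperplane)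
  have normalize: "(1 / (e \<bullet> w)) *\<^sub>R w \<in> B" if "w \<in> K" "w \<noteq> 0" for w
  proof -
    have "e \<bullet> w > 0"
      using self_dual_cone_interior_inner_pos[OF K e(1) that] by (simp add: inner_commute)
    then show ?thesis
      using self_dual_cone_comb[OF K that(1) that(1), of "1 / (e \<bullet> w)" 0] by (simp add: B_def)
  qed
  have B_ne: "B \<noteq> {}"
    using normalize[of e] e interior_subset by blast
  \<comment> \<open>The fixed points of this projection are the solutions \<open>u\<close> of the
    variational inequality \<langle>Au, w - u\<rangle> \<ge> 0 for all \<open>w\<close> in
    \<open>B\<close>.\<close>
  define F where "F u = closest_point B (u - A *v u)" for u
  have "continuous_on B F"
    unfolding F_def
    by (intro continuous_on_compose2[OF continuous_on_closest_point[OF convex_B closed_B B_ne]]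
        continuous_intros matrix_vector_mult_linear_continuous_on) auto
  moreover have "F \<in> B \<rightarrow> B"
    using closest_point_in_set[OF closed_B B_ne] by (simp add: F_def)
  ultimately obtain u where u: "u \<in> B" "F u = u"
    using brouwer[OF compact_B convex_B B_ne] by blast
  have u_nz: "u \<noteq> 0"
    using u(1) by (auto simp: B_def)
  have Au_u: "(A *v u) \<bullet> u = 0"
    using inner_skew_symmetric[OF skew, of u u] by simp
  \<comment> \<open>As \<open>u\<close> is the point of \<open>B\<close> closest to
    \<open>u - A *v u\<close>, the obtuse angle criterion reads \<langle>-Au, w - u\<rangle> \<le>
    0, and the term \<langle>Au, u\<rangle> vanishes.\<close>
  have on_B: "(A *v u) \<bullet> w \<ge> 0" if "w \<in> B" for w
    using closest_point_dot[OF convex_B closed_B that, of "u - A *v u"] u(2) Au_u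
    by (simp add: F_def inner_diff_right)
  \<comment> \<open>Every nonzero \<open>w\<close> in \<open>K\<close> is a positive multiple of a
    point of \<open>B\<close>, so the inequality extends from the base to the cone.\<close>
  have "w \<bullet> (A *v u) \<ge> 0" if w: "w \<in> K" for w
  proof (cases "w = 0")
    case False
    then have "e \<bullet> w > 0"
      using self_dual_cone_interior_inner_pos[OF K e(1) w] by (simp add: inner_commute)
    then show ?thesis
      using on_B[OF normalize[OF w False]] by (simp add: inner_commute zero_le_divide_iff)
  qed simp
  then have "A *v u \<in> K"
    using self_dual_cone_mem_iff[OF K] by blast
  then show ?thesis
    using that u(1) u_nz by (auto simp: B_def)
qed

text \<open>The choice \<open>v = u\<close> would give quotient 0, but \<open>u\<close> may lie on
  the boundary. A convex set with nonempty interior lies in the closure of that interior, and the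
  quotient is continuous at \<open>v = u\<close> because \<langle>u, u\<rangle> is nonzero.\<close>

lemma INF_lambda_quotient_le_0:
  fixes A :: "real ^ 'n ^ 'n"
  assumes K: "self_dual_solid_convex_cone K" and skew: "transpose A = - A"
    and u: "u \<in> K" "u \<noteq> 0"
  shows "(INF v\<in>interior K. ereal (lambda_quotient A u v)) \<le> 0"
proof -
  have "interior K \<noteq> {}"
    using K unfolding self_dual_solid_convex_cone_def by (elim conjE)
  then have "u \<in> closure (interior K)"
    using convex_closure_interior[OF self_dual_cone_convex[OF K]] u(1) closure_subset by blast
  then obtain v where v: "\<And>k. v k \<in> interior K" "v \<longlonglongrightarrow> u"
    unfolding closure_sequential by blast
  have "(\<lambda>k. lambda_quotient A u (v k)) \<longlonglongrightarrow> lambda_quotient A u u"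
    unfolding lambda_quotient_def using u(2) by (intro tendsto_intros v) simp
  moreover have "lambda_quotient A u u = 0"
    using inner_skew_symmetric[OF skew, of u u] by (simp add: lambda_quotient_def)
  ultimately have "(\<lambda>k. ereal (lambda_quotient A u (v k))) \<longlonglongrightarrow> 0"
    by (simp add: zero_ereal_def)
  then show ?thesis
    by (rule LIMSEQ_le_const) (use v(1) in \<open>auto intro!: INF_lower\<close>)
qed

theorem corollary1p5:
  fixes A :: "real ^ 'n ^ 'n" and C :: "(real ^ 'n) set"
  assumes "transpose A = - A"
    and "C \<in> punctured_cones"
  shows "lower_quasi_eigenvalue C A = upper_quasi_eigenvalue C A \<and>
         upper_quasi_eigenvalue C A = 0"
proof -
  obtain K where C: "C = K - {0}" and K: "self_dual_solid_convex_cone K"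
    using assms(2) by (auto simp: punctured_cones_def)
  have int: "cone_interior C = interior K"
    unfolding cone_interior_def C insert_zero_punctured_cone[OF K] ..
  have "upper_quasi_eigenvalue C A \<le> 0"
    unfolding upper_quasi_eigenvalue_def int
    using INF_lambda_quotient_le_0[OF K assms(1)] by (auto simp: C intro!: SUP_least)
  moreover have "upper_quasi_eigenvalue C A \<ge> 0"
  proof -
    obtain u where u: "u \<in> K" "u \<noteq> 0" "A *v u \<in> K"
      using self_dual_cone_skew_symmetric_point[OF K assms(1)] .
    have "lambda_quotient A u v \<ge> 0" if v: "v \<in> interior K" for v
    proof -
      have "v \<in> K"
        using v interior_subset by blast
      then have "(A *v u) \<bullet> v \<ge> 0" "u \<bullet> v \<ge> 0"
        using u self_dual_cone_mem_iff[OF K] by blast+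
      then show ?thesis
        by (simp add: lambda_quotient_def)
    qed
    then show ?thesis
      unfolding upper_quasi_eigenvalue_def int using u
      by (intro SUP_upper2[of u]) (auto simp: C intro!: INF_greatest)
  qed
  moreover have "lower_quasi_eigenvalue C A = - upper_quasi_eigenvalue C A"
  proof -
    \<comment> \<open>The numerator is antisymmetric and the denominator symmetric; negation then
      exchanges suprema and infima in the extended reals.\<close>
    have neg: "ereal (lambda_quotient A u v) = - ereal (lambda_quotient A v u)" for u v
      using inner_skew_symmetric[OF assms(1), of u v]
      by (simp add: lambda_quotient_def inner_commute)
    have "lower_quasi_eigenvalue C A =
        (INF v\<in>C. SUP u\<in>cone_interior C. - ereal (lambda_quotient A v u))"
      unfolding lower_quasi_eigenvalue_def by (intro INF_cong SUP_cong refl neg)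
    then show ?thesis
      by (simp only: upper_quasi_eigenvalue_def ereal_SUP_uminus_eq ereal_INF_uminus_eq)
  qed
  ultimately show ?thesis by auto
qed

end
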